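(* Let $\mathcal{P}$ be a finite index set, $\{A_p : p\in\mathcal{P}\}$ a collection of real $n\times n$ matrices, each either stable or unstable, and $\mathcal{R}=\{R_{(p,q)} : p,q\in\mathcal{P}\}$ a collection of nonzero real $n\times n$ matrices. Let $\mathcal{G}$ be a directed graph on the subsystems such that its subgraph $\mathcal{G}_u$ is acyclic. For each $p\in\mathcal{P}$ fix a complex Jordan decomposition $A_p=P_pJ_pP_p^{-1}$ and constants $c_p>0$ and $\lambda_p^*>0$ (if $A_p$ is stable) or $\mu_p^*>0$ (if $A_p$ is unstable) such that, for all $t>0$, $\|e^{J_pt}\|\le c_pe^{-\lambda_p^*t}$ if $A_p$ is stable and $\|e^{J_pt}\|\le c_pe^{\mu_p^*t}$ if $A_p$ is unstable. Set $$\tau_R=\max_{(p,q)\in\mathcal{E}(\mathcal{G}_s)}\frac{\ln\left(c_p\,\|P_q^{-1}R_{(p,q)}P_p\|\right)}{\lambda_p^*},\qquad \eta_R=-\max_{(p,q)\in\mathcal{E}(\mathcal{G}_u)}\frac{\ln\left(c_p\,\|P_q^{-1}R_{(p,q)}P_p\|\right)}{\mu_p^*}.$$ Then the reset switched system $\dot x(t)=A_{\sigma(t)}x(t)$, $x(t_k)=R_{(\sigma(t_{k-1}),\sigma(t_k))}\,x(t_k^-)$ ($k\ge1$) is stable for all switching signals $\sigma\in\mathcal{S}^{\mathcal{G}}[\tau_R,\eta_R]$.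
   Context: A real matrix is called stable if all its eigenvalues have negative real part, and unstable if at least one eigenvalue has positive real part. $\|\cdot\|$ is the Euclidean norm for vectors and the spectral norm for matrices. A switching signal is a right-continuous piecewise constant function $\sigma:[0,\infty)\to\mathcal{P}$ whose set of discontinuities $\{t_k\}_{k\ge1}$ (switching times) is an increasing sequence with $t_k\uparrow\infty$; put $t_0=0$. Graph: $\mathcal{G}$ is a directed graph with vertices the subsystems $A_p$, identified with $p\in\mathcal{P}$, such that every $p$ has at least one outgoing edge $(p,q)\in\mathcal{E}(\mathcal{G})$. $\mathcal{G}_s$ and $\mathcal{G}_u$ are the subgraphs with the same vertices and with edges $\mathcal{E}(\mathcal{G}_s)=\{(p,q)\in\mathcal{E}(\mathcal{G}) : A_p \text{ stable}\}$, $\mathcal{E}(\mathcal{G}_u)=\{(p,q)\in\mathcal{E}(\mathcal{G}) : A_p \text{ unstable}\}$. A signal $\sigma$ is $\mathcal{G}$-admissible if $(\sigma(t_{k-1}),\sigma(t_k))\in\mathcal{E}(\mathcal{G})$ for all $k\ge1$. $\mathcal{S}^{\mathcal{G}}[\tau,\eta]$ is the set of $\mathcal{G}$-admissible switching signals such that for all $k\ge1$: $t_k-t_{k-1}\ge\tau$ if $A_{\sigma(t_{k-1})}$ is stable, and $t_k-t_{k-1}\le\eta$ if $A_{\sigma(t_{k-1})}$ is unstable (if there are no stable, resp. no unstable, subsystems, the constraint involving $\tau$, resp. $\eta$, is absent). In the reset switched system, $\dot x=A_{\sigma(t)}x$ holds on each $[t_{k-1},t_k)$ and $x(t_k^-)=\lim_{t\to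 t_k^-}x(t)$. The system (for fixed $\sigma$) is stable if for every $\epsilon>0$ there is $\delta>0$ such that $\|x(0)\|<\delta$ implies $\|x(t)\|<\epsilon$ for all $t>0$. *)

theory Defs
  imports "HOL-Analysis.Analysis" "Jordan_Normal_Form.Jordan_Normal_Form"
begin

hide_const (open) Matrix.vec Matrix.mat
no_notation Matrix.vec_index (infixl "$" 100)
no_notation Matrix.scalar_prod (infix "\<bullet>" 70)

type_synonym ('a, 'n) sqmat = "(('a, 'n) Finite_Cartesian_Product.vec, 'n) Finite_Cartesian_Product.vec"

abbreviation cmatrix :: "real^'n^'m \<Rightarrow> complex^'n^'m" where
  "cmatrix \<equiv> map_matrix complex_of_real"

text \<open>For matrices over the reals or the complex numbers, \<open>norm\<close> is the Frobenius norm;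
  the spectral norm is the operator norm induced by the Euclidean norm.\<close>

definition spectral_norm :: "('a::real_normed_field)^'n^'m \<Rightarrow> real" where
  "spectral_norm M = onorm ((*v) M)"

text \<open>The type class power operation on square matrices is componentwise, and so
  \<open>exp\<close> and \<open>(^)\<close> of the library cannot be used.\<close>

primrec matrix_power :: "('a::semiring_1, 'n::finite) sqmat \<Rightarrow> nat \<Rightarrow> ('a, 'n) sqmat" where
  "matrix_power M 0 = mat 1"
| "matrix_power M (Suc k) = M ** matrix_power M k"

definition matrix_exp :: "('a::real_normed_field, 'n::finite) sqmat \<Rightarrow> ('a, 'n) sqmat" where
  "matrix_exp M = (\<Sum>k. (1 / fact k :: real) *\<^sub>R matrix_power M k)"

text \<open>Rows and columns are numbered along the linear order of the index type.\<close>

definition to_mat :: "('a, 'n::{finite,linorder}) sqmat \<Rightarrow> 'a Matrix.mat" where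
  "to_mat M = Matrix.mat CARD('n) CARD('n)
     (\<lambda>(i, j). M $ (sorted_list_of_set UNIV ! i) $ (sorted_list_of_set UNIV ! j))"

definition stable_matrix :: "(real, 'n::{finite,linorder}) sqmat \<Rightarrow> bool" where
  "stable_matrix M \<longleftrightarrow> (\<forall>z. eigenvalue (to_mat (cmatrix M)) z \<longrightarrow> Re z < 0)"

definition unstable_matrix :: "(real, 'n::{finite,linorder}) sqmat \<Rightarrow> bool" where
  "unstable_matrix M \<longleftrightarrow> (\<exists>z. eigenvalue (to_mat (cmatrix M)) z \<and> Re z > 0)"

text \<open>The list \<open>n_as\<close> contains the pairs of block size and eigenvalue.\<close>

definition is_jordan_matrix :: "(complex, 'n::{finite,linorder}) sqmat \<Rightarrow> bool" where
  "is_jordan_matrix J \<longleftrightarrow> (\<exists>n_as. 0 \<notin> fst ` set n_as \<and> to_mat J = jordan_matrix n_as)"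

definition jordan_decomposition ::
  "(real, 'n::{finite,linorder}) sqmat \<Rightarrow> (complex, 'n) sqmat \<Rightarrow> (complex, 'n) sqmat \<Rightarrow> bool" where
  "jordan_decomposition M S J \<longleftrightarrow>
     is_jordan_matrix J \<and> invertible S \<and> cmatrix M = S ** J ** matrix_inv S"

text \<open>Signals are functions on all of \<open>real\<close> of which only the values on \<open>{0..}\<close>
  matter. Continuity is with respect to the discrete topology on the index type.\<close>

definition discontinuities :: "(real \<Rightarrow> 'p) \<Rightarrow> real set" where
  "discontinuities \<sigma> = {s. s \<ge> 0 \<and> \<not> (\<forall>\<^sub>F u in at s within {0..}. \<sigma> u = \<sigma> s)}"

definition enumerates_switches :: "(real \<Rightarrow> 'p) \<Rightarrow> (nat \<Rightarrow> real) \<Rightarrow> bool" where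
  "enumerates_switches \<sigma> t \<longleftrightarrow>
     t 0 = 0 \<and> strict_mono t \<and> t ` {1..} = discontinuities \<sigma>"

definition switching_signal :: "(real \<Rightarrow> 'p) \<Rightarrow> bool" where
  "switching_signal \<sigma> \<longleftrightarrow>
     (\<forall>s\<ge>0. \<forall>\<^sub>F u in at_right s. \<sigma> u = \<sigma> s) \<and>
     (\<exists>t. enumerates_switches \<sigma> t \<and> filterlim t at_top sequentially \<and>
          (\<forall>k. \<sigma> constant_on {t k<..<t (Suc k)}))"

definition switching_time :: "(real \<Rightarrow> 'p) \<Rightarrow> nat \<Rightarrow> real" where
  "switching_time \<sigma> = (THE t. enumerates_switches \<sigma> t)"

lemma enumerates_switches_unique:
  assumes s: "enumerates_switches \<sigma> s" and t: "enumerates_switches \<sigma> t"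
  shows "s = t"
proof -
  have *: "a k \<le> b k"
    if a: "enumerates_switches \<sigma> a" and b: "enumerates_switches \<sigma> b"
      and IH: "\<And>m. m < k \<Longrightarrow> a m = b m" for a b and k :: nat
  proof (cases "k = 0")
    case True
    then show ?thesis using a b by (simp add: enumerates_switches_def)
  next
    case False
    then have "b k \<in> a ` {1..}"
      using a b by (auto simp: enumerates_switches_def)
    then obtain m where m: "b k = a m" by auto
    have "\<not> m < k"
      using IH[of m] m b by (metis enumerates_switches_def less_irrefl strict_mono_less)
    then show ?thesis
      using m a by (simp add: enumerates_switches_def strict_mono_less_eq)
  qed
  have "s k = t k" for k
  proof (induction k rule: less_induct)
    case (less k)
    then show ?case using *[OF s t] *[OF t s] by (metis order_antisym)
  qed
  then show ?thesis by blast
qed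

lemma switching_time_eq: "enumerates_switches \<sigma> t \<Longrightarrow> switching_time \<sigma> = t"
  unfolding switching_time_def by (blast intro: the_equality enumerates_switches_unique)

definition stable_edges ::
  "('p \<Rightarrow> (real, 'n::{finite,linorder}) sqmat) \<Rightarrow> ('p \<times> 'p) set \<Rightarrow> ('p \<times> 'p) set" where
  "stable_edges A E = {(p, q). (p, q) \<in> E \<and> stable_matrix (A p)}"

definition unstable_edges ::
  "('p \<Rightarrow> (real, 'n::{finite,linorder}) sqmat) \<Rightarrow> ('p \<times> 'p) set \<Rightarrow> ('p \<times> 'p) set" where
  "unstable_edges A E = {(p, q). (p, q) \<in> E \<and> unstable_matrix (A p)}"

definition admissible :: "('p \<times> 'p) set \<Rightarrow> (real \<Rightarrow> 'p) \<Rightarrow> bool" where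
  "admissible E \<sigma> \<longleftrightarrow>
     (\<forall>k. (\<sigma> (switching_time \<sigma> k), \<sigma> (switching_time \<sigma> (Suc k))) \<in> E)"

definition dwell_flee_signals ::
  "('p \<Rightarrow> (real, 'n::{finite,linorder}) sqmat) \<Rightarrow> ('p \<times> 'p) set \<Rightarrow> real \<Rightarrow> real \<Rightarrow> (real \<Rightarrow> 'p) set"
where
  "dwell_flee_signals A E \<tau> \<eta> = {\<sigma>. switching_signal \<sigma> \<and> admissible E \<sigma> \<and>
     (\<forall>k. let t = switching_time \<sigma> k; t' = switching_time \<sigma> (Suc k) in
        (stable_matrix (A (\<sigma> t)) \<longrightarrow> t' - t \<ge> \<tau>) \<and>
        (unstable_matrix (A (\<sigma> t)) \<longrightarrow> t' - t \<le> \<eta>))}"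

text \<open>At the left endpoint of each interval the derivative is the right derivative.\<close>

definition reset_solution ::
  "('p \<Rightarrow> (real, 'n::finite) sqmat) \<Rightarrow> ('p \<Rightarrow> 'p \<Rightarrow> (real, 'n) sqmat) \<Rightarrow> (real \<Rightarrow> 'p) \<Rightarrow> (real \<Rightarrow> real^'n) \<Rightarrow> bool"
where
  "reset_solution A R \<sigma> x \<longleftrightarrow>
     (\<forall>k. \<forall>s \<in> {switching_time \<sigma> k..<switching_time \<sigma> (Suc k)}.
        (x has_vector_derivative A (\<sigma> s) *v x s)
          (at s within {switching_time \<sigma> k..<switching_time \<sigma> (Suc k)})) \<and>
     (\<forall>k. \<exists>xm. (x \<longlongrightarrow> xm) (at_left (switching_time \<sigma> (Suc k))) \<and>
        x (switching_time \<sigma> (Suc k)) =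
          R (\<sigma> (switching_time \<sigma> k)) (\<sigma> (switching_time \<sigma> (Suc k))) *v xm)"

definition reset_system_stable ::
  "('p \<Rightarrow> (real, 'n::finite) sqmat) \<Rightarrow> ('p \<Rightarrow> 'p \<Rightarrow> (real, 'n) sqmat) \<Rightarrow> (real \<Rightarrow> 'p) \<Rightarrow> bool" where
  "reset_system_stable A R \<sigma> \<longleftrightarrow>
     (\<forall>\<epsilon>>0. \<exists>\<delta>>0. \<forall>x. reset_solution A R \<sigma> x \<longrightarrow> norm (x 0) < \<delta> \<longrightarrow>
        (\<forall>s>0. norm (x s) < \<epsilon>))"

text \<open>If there are no stable (unstable) edges then \<open>tau_R\<close> (\<open>eta_R\<close>) is the
  maximum of the empty set and so unspecified. As every vertex has an outgoing edge, there is
  then no stable (unstable) subsystem, and \<open>dwell_flee_signals\<close> does not depend on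
  this value.\<close>

definition tau_R ::
  "('p \<Rightarrow> (real, 'n::{finite,linorder}) sqmat) \<Rightarrow> ('p \<Rightarrow> 'p \<Rightarrow> (real, 'n) sqmat) \<Rightarrow> ('p \<times> 'p) set \<Rightarrow>
   ('p \<Rightarrow> (complex, 'n) sqmat) \<Rightarrow> ('p \<Rightarrow> real) \<Rightarrow> ('p \<Rightarrow> real) \<Rightarrow> real" where
  "tau_R A R E P c lam = (MAX (p, q) \<in> stable_edges A E.
     ln (c p * spectral_norm (matrix_inv (P q) ** cmatrix (R p q) ** P p)) / lam p)"

definition eta_R ::
  "('p \<Rightarrow> (real, 'n::{finite,linorder}) sqmat) \<Rightarrow> ('p \<Rightarrow> 'p \<Rightarrow> (real, 'n) sqmat) \<Rightarrow> ('p \<times> 'p) set \<Rightarrow>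
   ('p \<Rightarrow> (complex, 'n) sqmat) \<Rightarrow> ('p \<Rightarrow> real) \<Rightarrow> ('p \<Rightarrow> real) \<Rightarrow> real" where
  "eta_R A R E P c mu = - (MAX (p, q) \<in> unstable_edges A E.
     ln (c p * spectral_norm (matrix_inv (P q) ** cmatrix (R p q) ** P p)) / mu p)"

end

theory Submission
  imports Defs
begin

text \<open>On an interval where the active subsystem is \<open>p\<close>, the coordinates \<open>w = P\<^sub>p\<inverse> x\<close> solve
  \<open>w' = J\<^sub>p w\<close>, so \<open>w(s) = exp ((s - t\<^sub>k) J\<^sub>p) w(t\<^sub>k)\<close>. The thresholds \<open>\<tau>\<^sub>R\<close> and \<open>\<eta>\<^sub>R\<close> are
  chosen so that the flow on a whole interval followed by the reset \<open>P\<^sub>q\<inverse> R\<^sub>p\<^sub>q P\<^sub>p\<close> is a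
  contraction in these coordinates. Hence \<open>norm (w(t\<^sub>k))\<close> is nonincreasing in \<open>k\<close>, and between
  switches \<open>w\<close> grows by a bounded factor, since intervals with an unstable subsystem have length at
  most \<open>\<eta>\<^sub>R\<close>.\<close>

section \<open>Powers and exponentials of square matrices\<close>

lemma matrix_power_commute: "matrix_power M k ** M = M ** matrix_power M k"
  by (induction k) (simp_all add: matrix_mul_assoc[symmetric])

lemma matrix_power_scaleR:
  fixes M :: "('a::real_normed_field, 'n::finite) sqmat"
  shows "matrix_power (t *\<^sub>R M) k = t ^ k *\<^sub>R matrix_power M k"
proof (induction k)
  case (Suc k)
  have "(t *\<^sub>R M) ** (t ^ k *\<^sub>R matrix_power M k) = (t * t ^ k) *\<^sub>R (M ** matrix_power M k)"
    by (simp add: Finite_Cartesian_Product.vec_eq_iff matrix_matrix_mult_def scaleR_sum_right mult.commute)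
  then show ?case using Suc by simp
qed simp

text \<open>In finite dimension every bilinear map is bounded. The constant obtained this way stands
  in for submultiplicativity of the norm in the convergence proof below.\<close>

lemma bounded_bilinear_matrix_mult:
  "bounded_bilinear ((**) :: ('a::{euclidean_space,real_normed_field})^'n^'m \<Rightarrow> 'a^'k^'n \<Rightarrow> 'a^'k^'m)"
proof -
  have "bilinear ((**) :: 'a^'n^'m \<Rightarrow> 'a^'k^'n \<Rightarrow> 'a^'k^'m)"
    unfolding bilinear_def
    by (auto intro!: linearI simp: Finite_Cartesian_Product.vec_eq_iff matrix_matrix_mult_def sum.distrib
        distrib_left distrib_right scaleR_sum_right)
  then show ?thesis by (simp add: bilinear_conv_bounded_bilinear)
qed

text \<open>Comparison with a scalar exponential series: with \<open>K\<close> bounding the product,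
  \<open>norm (matrix_power M k)\<close> grows at most like the powers of
  \<open>norm M * K\<close>.\<close>

lemma summable_matrix_exp:
  fixes M :: "('a::{euclidean_space,real_normed_field}, 'n::finite) sqmat"
  shows "summable (\<lambda>k. (1 / fact k :: real) *\<^sub>R matrix_power M k)"
proof -
  obtain K where K: "K > 0" "\<And>(X :: 'a^'n^'n) (Y :: 'a^'n^'n). norm (X ** Y) \<le> norm X * norm Y * K"
    using bounded_bilinear.pos_bounded[OF bounded_bilinear_matrix_mult] by blast
  define b where "b = norm M * K"
  have pow: "norm (matrix_power M k) \<le> b ^ k * norm (mat 1 :: 'a^'n^'n)" for k
  proof (induction k)
    case (Suc k)
    have "norm (matrix_power M (Suc k)) \<le> b * norm (matrix_power M k)"
      using K(2)[of M "matrix_power M k"] by (simp add: b_def mult_ac)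
    also have "\<dots> \<le> b * (b ^ k * norm (mat 1 :: 'a^'n^'n))"
      using Suc K(1) by (intro mult_left_mono) (auto simp: b_def)
    finally show ?case by (simp add: mult.assoc)
  qed simp
  show ?thesis
  proof (rule summable_comparison_test')
    show "summable (\<lambda>k. inverse (fact k) * b ^ k * norm (mat 1 :: 'a^'n^'n))"
      by (intro summable_mult2 summable_exp)
    show "norm ((1 / fact k :: real) *\<^sub>R matrix_power M k)
        \<le> inverse (fact k) * b ^ k * norm (mat 1 :: 'a^'n^'n)" for k
      using mult_left_mono[OF pow[of k], of "inverse (fact k)"] by (simp add: divide_inverse mult_ac)
  qed
qed

text \<open>Evaluation at \<open>v\<close> is a bounded linear map on matrices, so it may be applied
  to the exponential series term by term. The terms then have the shape of Taylor terms.\<close>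

lemma matrix_exp_mult_sums:
  fixes M :: "('a::{euclidean_space,real_normed_field}, 'n::finite) sqmat"
  shows "(\<lambda>k. (t ^ k / fact k) *\<^sub>R (matrix_power M k *v v)) sums (matrix_exp (t *\<^sub>R M) *v v)"
proof -
  have "linear (\<lambda>X :: 'a^'n^'n. X *v v)"
    by (intro linearI)
      (simp_all add: Finite_Cartesian_Product.vec_eq_iff matrix_vector_mult_def sum.distrib distrib_right scaleR_sum_right)
  then have bl: "bounded_linear (\<lambda>X :: 'a^'n^'n. X *v v)"
    by (simp add: linear_conv_bounded_linear)
  have "(\<lambda>k. (1 / fact k :: real) *\<^sub>R matrix_power (t *\<^sub>R M) k) sums matrix_exp (t *\<^sub>R M)"
    unfolding matrix_exp_def by (rule summable_sums[OF summable_matrix_exp])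
  from bounded_linear.sums[OF bl this] show ?thesis
    by (simp add: matrix_power_scaleR linear_scale[OF bounded_linear.linear[OF bl]])
qed

section \<open>Spectral norm bounds and linear differential equations\<close>

lemma norm_mult_le_spectral_norm:
  fixes M :: "('a::{euclidean_space,real_normed_field})^'n^'m"
  shows "norm (M *v v) \<le> spectral_norm M * norm v"
  unfolding spectral_norm_def by (rule onorm[OF matrix_vector_mul_bounded_linear])

lemma spectral_norm_nonneg:
  fixes M :: "('a::{euclidean_space,real_normed_field})^'n^'m"
  shows "0 \<le> spectral_norm M"
  unfolding spectral_norm_def by (rule onorm_pos_le[OF matrix_vector_mul_bounded_linear])

text \<open>Taylor expansion at \<open>a\<close>: the \<open>k\<close>-th derivative of a solution
  is \<open>matrix_power M k *v z s\<close>, so the Taylor polynomials at \<open>b\<close> are the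
  partial sums of the exponential series, and the remainder tends to 0.\<close>

lemma linear_ode_solution_eq_matrix_exp:
  fixes M :: "('a::{euclidean_space,real_normed_field}, 'n::finite) sqmat"
  assumes "a \<le> b"
    and deriv: "\<And>s. s \<in> {a..b} \<Longrightarrow> (z has_vector_derivative M *v z s) (at s within {a..b})"
  shows "z b = matrix_exp ((b - a) *\<^sub>R M) *v z a"
proof -
  define D where "D k s = matrix_power M k *v z s" for k s
  have D_0: "D 0 = z" by (simp add: D_def fun_eq_iff)
  have D_deriv: "(D k has_vector_derivative D (Suc k) s) (at s within {a..b})" if "s \<in> {a..b}" for k s
  proof -
    have "D (Suc k) s = matrix_power M k *v (M *v z s)"
      by (simp add: D_def matrix_vector_mul_assoc matrix_power_commute)
    then show ?thesis
      unfolding D_def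
      using bounded_linear.has_vector_derivative[OF matrix_vector_mul_bounded_linear deriv[OF that]]
      by simp
  qed
  \<comment> \<open>Compactness bounds \<open>z\<close> by a single \<open>B\<close>, and hence the
    \<open>k\<close>-th derivative by \<open>K ^ k * B\<close> uniformly on the interval.\<close>
  have "continuous_on {a..b} z"
    using deriv by (meson continuous_on_eq_continuous_within has_vector_derivative_continuous)
  then have "bounded (z ` {a..b})"
    by (intro compact_imp_bounded compact_continuous_image) auto
  then obtain B where B: "\<And>s. s \<in> {a..b} \<Longrightarrow> norm (z s) \<le> B"
    by (metis bounded_iff image_eqI)
  define K where "K = spectral_norm M"
  have K: "K \<ge> 0" unfolding K_def by (rule spectral_norm_nonneg)
  have D_le: "norm (D k s) \<le> K ^ k * B" if "s \<in> {a..b}" for k s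
  proof (induction k)
    case 0
    then show ?case using B[OF that] by (simp add: D_def)
  next
    case (Suc k)
    have "norm (D (Suc k) s) \<le> K * norm (D k s)"
      unfolding D_def K_def matrix_power.simps matrix_vector_mul_assoc[symmetric]
      by (rule norm_mult_le_spectral_norm)
    also have "\<dots> \<le> K * (K ^ k * B)" using Suc K by (rule mult_left_mono)
    finally show ?case by (simp add: mult.assoc)
  qed
  let ?T = "\<lambda>n. \<Sum>i<n. ((b - a) ^ i / fact i) *\<^sub>R D i a"
  \<comment> \<open>The bound on the integral remainder, arranged as a constant times the
    \<open>n\<close>-th term of the scalar exponential series at \<open>(b - a) * K\<close>; it
    vanishes in the limit because that series converges.\<close>
  let ?r = "\<lambda>n. inverse (fact n) * ((b - a) * K) ^ n * ((b - a) * K * B)"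
  have remainder: "norm (z b - ?T (Suc n)) \<le> ?r n" for n
  proof -
    let ?i = "\<lambda>x. ((b - x) ^ n / fact n) *\<^sub>R D (Suc n) x"
    have "(?i has_integral z b - ?T (Suc n)) {a..b}"
      using Taylor_has_integral[of "Suc n" D z a b] \<open>a \<le> b\<close> D_deriv D_0 by simp
    moreover have "norm (?i x) \<le> (b - a) ^ n / fact n * (K ^ Suc n * B)" if "x \<in> {a..b}" for x
    proof -
      have "norm (?i x) = (b - x) ^ n / fact n * norm (D (Suc n) x)" using that by simp
      also have "\<dots> \<le> (b - a) ^ n / fact n * (K ^ Suc n * B)"
        using that by (intro mult_mono D_le divide_right_mono power_mono) auto
      finally show ?thesis .
    qed
    moreover have "0 \<le> (b - a) ^ n / fact n * (K ^ Suc n * B)"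
      using \<open>a \<le> b\<close> K order_trans[OF norm_ge_zero B[of a]] by simp
    ultimately have "norm (z b - ?T (Suc n)) \<le> (b - a) ^ n / fact n * (K ^ Suc n * B) * (b - a)"
      using has_integral_bound_real[where f = ?i and a = a and b = b and S = "{}"] \<open>a \<le> b\<close>
      by (simp only: content_real finite.emptyI Diff_empty)
    also have "\<dots> = ?r n" by (simp add: power_mult_distrib divide_inverse mult_ac)
    finally show ?thesis .
  qed
  have "?r \<longlonglongrightarrow> 0"
    by (intro summable_LIMSEQ_zero summable_mult2 summable_exp)
  then have "(\<lambda>n. z b - ?T (Suc n)) \<longlonglongrightarrow> 0"
    by (rule Lim_null_comparison[OF always_eventually[OF allI[OF remainder]]])
  then have "(\<lambda>n. z b - (z b - ?T (Suc n))) \<longlonglongrightarrow> z b - 0"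
    by (intro tendsto_diff tendsto_const)
  then have "(\<lambda>n. ?T (Suc n)) \<longlonglongrightarrow> z b" by simp
  moreover have "(\<lambda>n. ?T (Suc n)) \<longlonglongrightarrow> matrix_exp ((b - a) *\<^sub>R M) *v z a"
    using matrix_exp_mult_sums[of "b - a" M "z a"] unfolding sums_def D_def by (rule LIMSEQ_Suc)
  ultimately show ?thesis by (rule LIMSEQ_unique)
qed


section \<open>Complexification and Jordan coordinates\<close>

definition cvec :: "real^'n \<Rightarrow> complex^'n" where
  "cvec v = (\<chi> i. complex_of_real (v $ i))"

lemma norm_cvec [simp]: "norm (cvec v) = norm v"
  by (simp add: norm_vec_def cvec_def)

lemma bounded_linear_cvec: "bounded_linear cvec"
  unfolding linear_conv_bounded_linear[symmetric]
  by (intro linearI) (simp_all add: Finite_Cartesian_Product.vec_eq_iff cvec_def complex_eq_iff)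

lemma cmatrix_mult_cvec: "cmatrix M *v cvec v = cvec (M *v v)"
  by (simp add: Finite_Cartesian_Product.vec_eq_iff cvec_def matrix_vector_mult_def)

lemma matrix_inv_inverse:
  assumes "invertible M"
  shows "M ** matrix_inv M = mat 1" and "matrix_inv M ** M = mat 1"
  using someI_ex[OF assms[unfolded invertible_def]] by (simp_all add: matrix_inv_def)

text \<open>Multiplying the equation by \<open>matrix_inv S\<close> turns \<open>M\<close> into
  \<open>J\<close>, since \<open>matrix_inv S ** cmatrix M = J ** matrix_inv S\<close>. The endpoint
  \<open>e\<close> is excluded because a solution may jump there; the exponential formula is applied
  on the closed interval up to \<open>b < e\<close>.\<close>

lemma jordan_coordinates_solution:
  assumes jd: "jordan_decomposition M S J" and "a \<le> b" "b < e"
    and deriv: "\<And>s. s \<in> {a..<e} \<Longrightarrow> (x has_vector_derivative M *v x s) (at s within {a..<e})"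
  shows "matrix_inv S *v cvec (x b) = matrix_exp ((b - a) *\<^sub>R J) *v (matrix_inv S *v cvec (x a))"
proof (rule linear_ode_solution_eq_matrix_exp[OF \<open>a \<le> b\<close>, where z = "\<lambda>s. matrix_inv S *v cvec (x s)"])
  fix s assume s: "s \<in> {a..b}"
  have inv: "matrix_inv S ** S = mat 1" and M: "cmatrix M = S ** J ** matrix_inv S"
    using jd by (auto simp: jordan_decomposition_def matrix_inv_inverse)
  have "matrix_inv S ** cmatrix M = (matrix_inv S ** S) ** J ** matrix_inv S"
    by (simp add: M matrix_mul_assoc)
  then have conj: "matrix_inv S ** cmatrix M = J ** matrix_inv S"
    by (simp add: inv)
  have "matrix_inv S *v cvec (M *v x s) = (matrix_inv S ** cmatrix M) *v cvec (x s)"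
    by (simp add: cmatrix_mult_cvec[symmetric] matrix_vector_mul_assoc)
  also have "\<dots> = J *v (matrix_inv S *v cvec (x s))"
    by (simp add: conj matrix_vector_mul_assoc)
  finally have eq: "matrix_inv S *v cvec (M *v x s) = J *v (matrix_inv S *v cvec (x s))" .
  have "(x has_vector_derivative M *v x s) (at s within {a..b})"
    using deriv[of s] s \<open>b < e\<close> by (auto intro: has_vector_derivative_within_subset)
  from bounded_linear.has_vector_derivative[OF matrix_vector_mul_bounded_linear
      bounded_linear.has_vector_derivative[OF bounded_linear_cvec this], of "matrix_inv S"]
  show "((\<lambda>s. matrix_inv S *v cvec (x s)) has_vector_derivative J *v (matrix_inv S *v cvec (x s)))
      (at s within {a..b})"
    by (simp add: eq)
qed

section \<open>Switching times and the intervals between them\<close>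

lemma switching_signalD:
  assumes "switching_signal \<sigma>"
  defines "t \<equiv> switching_time \<sigma>"
  shows switching_time_0: "t 0 = 0"
    and strict_mono_switching_time: "strict_mono t"
    and filterlim_switching_time: "filterlim t at_top sequentially"
    and switching_signal_eq: "s \<in> {t k..<t (Suc k)} \<Longrightarrow> \<sigma> s = \<sigma> (t k)"
proof -
  obtain t' where t': "enumerates_switches \<sigma> t'" "filterlim t' at_top sequentially"
      "\<And>k. \<sigma> constant_on {t' k<..<t' (Suc k)}"
    and rc: "\<And>s. s \<ge> 0 \<Longrightarrow> \<forall>\<^sub>F u in at_right s. \<sigma> u = \<sigma> s"
    using assms by (auto simp: switching_signal_def)
  have "t' = t" using switching_time_eq[OF t'(1)] by (simp add: t_def)
  note t = t'[unfolded this]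
  show t0: "t 0 = 0" and mono: "strict_mono t" and "filterlim t at_top sequentially"
    using t by (auto simp: enumerates_switches_def)
  have lt: "t k < t (Suc k)" using mono by (simp add: strict_mono_def)
  have "t k \<ge> 0" using mono t0 by (metis strict_mono_less_eq zero_le)
  \<comment> \<open>Right-continuity at \<open>t k\<close> supplies a point of the open interval
    with value \<open>\<sigma> (t k)\<close>, which identifies the constant value on that
    interval.\<close>
  have "\<forall>\<^sub>F u in at_right (t k). \<sigma> u = \<sigma> (t k) \<and> u \<in> {t k<..<t (Suc k)}"
    using rc[OF \<open>t k \<ge> 0\<close>] eventually_at_right_real[OF lt] by (rule eventually_conj)
  then obtain u where "\<sigma> u = \<sigma> (t k)" "u \<in> {t k<..<t (Suc k)}"
    using eventually_happens'[OF trivial_limit_at_right_real] by blast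
  moreover assume "s \<in> {t k..<t (Suc k)}"
  ultimately show "\<sigma> s = \<sigma> (t k)"
    using t(3)[of k] by (cases "s = t k") (auto simp: constant_on_def)
qed

text \<open>Divergence gives a least index \<open>n\<close> with \<open>s < t n\<close>. It is not
  0, because \<open>t 0 \<le> s\<close>, and its predecessor is the required
  \<open>k\<close>.\<close>

lemma strict_mono_interval:
  fixes t :: "nat \<Rightarrow> real"
  assumes "filterlim t at_top sequentially" "t 0 \<le> s"
  obtains k where "s \<in> {t k..<t (Suc k)}"
proof -
  have "\<exists>n. s < t n"
    using assms(1) by (auto simp: filterlim_at_top_dense eventually_sequentially)
  then have "s < t (LEAST n. s < t n)" by (rule LeastI_ex)
  moreover obtain k where k: "(LEAST n. s < t n) = Suc k"
    using calculation assms(2) by (metis not0_implies_Suc not_le)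
  moreover have "\<not> s < t k" using k by (metis lessI not_less_Least)
  ultimately have "s \<in> {t k..<t (Suc k)}" by simp
  then show ?thesis by (rule that)
qed

section \<open>Stability from contraction at the switches\<close>

text \<open>Stable and unstable subsystems are treated alike through a signed rate
  \<open>r p\<close>. Contraction over a full interval and its reset controls the state at all
  switching times, \<open>C\<close> limits the growth inside an interval, and finiteness of the
  index type makes the final constant uniform.\<close>

lemma reset_system_stable_if_contracting:
  fixes A :: "'p::finite \<Rightarrow> (real, 'n::{finite,linorder}) sqmat"
    and R :: "'p \<Rightarrow> 'p \<Rightarrow> (real, 'n) sqmat"
    and P J :: "'p \<Rightarrow> (complex, 'n) sqmat"
    and c r C :: "'p \<Rightarrow> real"
  assumes \<sigma>: "switching_signal \<sigma>"
    and jd: "\<And>p. jordan_decomposition (A p) (P p) (J p)"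
    and c: "\<And>p. c p > 0"
    and growth: "\<And>p t. t > 0 \<Longrightarrow> spectral_norm (matrix_exp (t *\<^sub>R J p)) \<le> c p * exp (r p * t)"
  defines "t \<equiv> switching_time \<sigma>"
  assumes bounded: "\<And>k. r (\<sigma> (t k)) * (t (Suc k) - t k) \<le> C (\<sigma> (t k))"
    and C: "\<And>p. C p \<ge> 0"
    and contracting: "\<And>k. c (\<sigma> (t k)) * spectral_norm (matrix_inv (P (\<sigma> (t (Suc k)))) **
        cmatrix (R (\<sigma> (t k)) (\<sigma> (t (Suc k)))) ** P (\<sigma> (t k))) *
        exp (r (\<sigma> (t k)) * (t (Suc k) - t k)) \<le> 1"
  shows "reset_system_stable A R \<sigma>"
proof -
  note t_facts = switching_signalD[OF \<sigma>, folded t_def]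
  have inv: "P p ** matrix_inv (P p) = mat 1" for p
    using jd[of p] by (auto simp: jordan_decomposition_def matrix_inv_inverse)
  have lt: "t k < t (Suc k)" for k using t_facts(2) by (simp add: strict_mono_def)
  \<comment> \<open>\<open>D p\<close> leads from the coordinates at the start of an interval back
    to \<open>x\<close>. Its summand 1 covers the left endpoint, where the growth estimate for
    positive times does not apply. The sum in \<open>K\<close> dominates \<open>D p\<close> for
    whichever subsystem is active.\<close>
  define D where "D p = spectral_norm (P p) * (1 + c p * exp (C p))" for p
  define K where "K = (\<Sum>p\<in>UNIV. D p) * spectral_norm (matrix_inv (P (\<sigma> 0)))"
  have D: "D p \<ge> 0" for p
    using c[of p] by (auto simp: D_def spectral_norm_nonneg intro!: mult_nonneg_nonneg add_nonneg_nonneg)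
  have bound: "norm (x s) \<le> K * norm (x 0)" if sol: "reset_solution A R \<sigma> x" and "s > 0" for x s
  proof -
    \<comment> \<open>The coordinates belong to the subsystem of the \<open>k\<close>-th interval,
      so at \<open>t (Suc k)\<close> the values of \<open>w k\<close> and \<open>w (Suc k)\<close>
      refer to different bases.\<close>
    define w where "w k s = matrix_inv (P (\<sigma> (t k))) *v cvec (x s)" for k s
    have x_eq: "cvec (x s) = P (\<sigma> (t k)) *v w k s" for k s
      by (simp add: w_def matrix_vector_mul_assoc inv)
    have flow: "norm (w k s) \<le> c (\<sigma> (t k)) * exp (r (\<sigma> (t k)) * (s - t k)) * norm (w k (t k))"
      if "s \<in> {t k<..<t (Suc k)}" for k s
    proof -
      have "w k s = matrix_exp ((s - t k) *\<^sub>R J (\<sigma> (t k))) *v w k (t k)"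
        unfolding w_def
      proof (rule jordan_coordinates_solution[OF jd])
        show "(x has_vector_derivative A (\<sigma> (t k)) *v x u) (at u within {t k..<t (Suc k)})"
          if "u \<in> {t k..<t (Suc k)}" for u
          using sol that t_facts(4)[OF that] unfolding reset_solution_def t_def by metis
      qed (use that in auto)
      then have "norm (w k s) \<le> spectral_norm (matrix_exp ((s - t k) *\<^sub>R J (\<sigma> (t k)))) * norm (w k (t k))"
        by (simp add: norm_mult_le_spectral_norm)
      also have "\<dots> \<le> c (\<sigma> (t k)) * exp (r (\<sigma> (t k)) * (s - t k)) * norm (w k (t k))"
        using that by (intro mult_right_mono growth) auto
      finally show ?thesis .
    qed
    have jump: "norm (w (Suc k) (t (Suc k))) \<le> norm (w k (t k))" for k
    proof -
      define p q where "p = \<sigma> (t k)" and "q = \<sigma> (t (Suc k))"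
      define M where "M = matrix_inv (P q) ** cmatrix (R p q) ** P p"
      obtain xm where xm: "(x \<longlongrightarrow> xm) (at_left (t (Suc k)))" "x (t (Suc k)) = R p q *v xm"
        using sol unfolding reset_solution_def t_def p_def q_def by blast
      \<comment> \<open>\<open>M\<close> undoes the coordinates of \<open>p\<close>, applies the
        reset and passes to the coordinates of \<open>q\<close>. Thus the left limit of
        \<open>M *v w k s\<close> is exactly the coordinate vector after the jump.\<close>
      have "((\<lambda>s. M *v w k s) \<longlongrightarrow> M *v (matrix_inv (P p) *v cvec xm)) (at_left (t (Suc k)))"
        unfolding w_def p_def[symmetric]
        by (intro bounded_linear.tendsto[OF matrix_vector_mul_bounded_linear]
            bounded_linear.tendsto[OF bounded_linear_cvec] xm)
      also have "M *v (matrix_inv (P p) *v cvec xm)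
          = (matrix_inv (P q) ** cmatrix (R p q) ** (P p ** matrix_inv (P p))) *v cvec xm"
        by (simp add: M_def matrix_vector_mul_assoc matrix_mul_assoc)
      also have "\<dots> = w (Suc k) (t (Suc k))"
        by (simp add: inv w_def xm(2) q_def[symmetric] cmatrix_mult_cvec[symmetric] matrix_vector_mul_assoc)
      finally have lim: "((\<lambda>s. norm (M *v w k s)) \<longlongrightarrow> norm (w (Suc k) (t (Suc k)))) (at_left (t (Suc k)))"
        by (rule tendsto_norm)
      have "norm (w (Suc k) (t (Suc k)))
          \<le> spectral_norm M * (c p * exp (r p * (t (Suc k) - t k)) * norm (w k (t k)))"
      \<comment> \<open>The flow estimate holds only before the jump and is carried to
        \<open>t (Suc k)\<close> by letting \<open>s\<close> tend to it from the left.\<close>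
      proof (rule tendsto_le[OF trivial_limit_at_left_real _ lim])
        show "((\<lambda>s. spectral_norm M * (c p * exp (r p * (s - t k)) * norm (w k (t k))))
            \<longlongrightarrow> spectral_norm M * (c p * exp (r p * (t (Suc k) - t k)) * norm (w k (t k))))
            (at_left (t (Suc k)))"
          by (intro tendsto_intros)
        show "\<forall>\<^sub>F s in at_left (t (Suc k)).
            norm (M *v w k s) \<le> spectral_norm M * (c p * exp (r p * (s - t k)) * norm (w k (t k)))"
          using eventually_at_left_real[OF lt]
        proof eventually_elim
          case (elim s)
          then show ?case
            using flow[OF elim] mult_left_mono[OF _ spectral_norm_nonneg]
            by (intro order_trans[OF norm_mult_le_spectral_norm]) (simp add: p_def)
        qed
      qed
      also have "\<dots> = c p * spectral_norm M * exp (r p * (t (Suc k) - t k)) * norm (w k (t k))"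
        by simp
      also have "\<dots> \<le> 1 * norm (w k (t k))"
        using contracting[of k] by (intro mult_right_mono) (simp_all add: p_def q_def M_def)
      finally show ?thesis by simp
    qed
    have switch: "norm (w k (t k)) \<le> norm (w 0 0)" for k
      by (induction k) (use jump t_facts(1) in \<open>auto intro: order_trans\<close>)
    obtain k where k: "s \<in> {t k..<t (Suc k)}"
      using strict_mono_interval[OF t_facts(3)] \<open>s > 0\<close> t_facts(1) by (metis less_eq_real_def)
    define p where "p = \<sigma> (t k)"
    have "norm (w k s) \<le> (1 + c p * exp (C p)) * norm (w k (t k))"
    proof (cases "s = t k")
      case True
      then show ?thesis
        using c[of p] by (simp add: distrib_right)
    next
      case False
      have "r p * (s - t k) \<le> C p"
      \<comment> \<open>For a nonnegative rate the exponent is largest at the end of the interval;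
        for a negative rate it is at most 0, hence at most \<open>C p\<close>.\<close>
      proof (cases "r p \<ge> 0")
        case True
        then have "r p * (s - t k) \<le> r p * (t (Suc k) - t k)"
          using k by (intro mult_left_mono) auto
        then show ?thesis using bounded[of k] by (simp add: p_def)
      next
        case False
        then have "r p * (s - t k) \<le> 0" using k by (simp add: mult_nonpos_nonneg)
        then show ?thesis using C[of p] by linarith
      qed
      then have "c p * exp (r p * (s - t k)) \<le> 1 + c p * exp (C p)"
        using c[of p] by (simp add: add_increasing)
      from mult_right_mono[OF this norm_ge_zero] show ?thesis
        using flow[of s k] k False unfolding p_def by (auto intro: order_trans)
    qed
    also have "\<dots> \<le> (1 + c p * exp (C p)) * norm (w 0 0)"
      using c[of p] by (intro mult_left_mono switch) (auto intro!: add_nonneg_nonneg)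
    finally have "spectral_norm (P p) * norm (w k s) \<le> D p * norm (w 0 0)"
      unfolding D_def by (simp add: mult_left_mono spectral_norm_nonneg mult.assoc)
    moreover have "norm (x s) \<le> spectral_norm (P p) * norm (w k s)"
      by (metis norm_cvec norm_mult_le_spectral_norm p_def x_eq)
    moreover have "D p * norm (w 0 0) \<le> (\<Sum>p\<in>UNIV. D p) * norm (w 0 0)"
      by (intro mult_right_mono member_le_sum) (auto simp: D)
    moreover have "(\<Sum>p\<in>UNIV. D p) * norm (w 0 0) \<le> K * norm (x 0)"
      using norm_mult_le_spectral_norm[of "matrix_inv (P (\<sigma> 0))" "cvec (x 0)"]
      unfolding K_def w_def t_facts(1) mult.assoc by (intro mult_left_mono sum_nonneg) (auto simp: D)
    ultimately show ?thesis by linarith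
  qed
  have K: "K \<ge> 0"
    unfolding K_def by (intro mult_nonneg_nonneg sum_nonneg D spectral_norm_nonneg)
  show ?thesis
    unfolding reset_system_stable_def
  proof (intro allI impI)
    fix \<epsilon> :: real assume "\<epsilon> > 0"
    \<comment> \<open>The choice is \<open>\<delta> = \<epsilon> / (K + 1)\<close>; adding 1 keeps
      the denominator positive, as \<open>K\<close> is only known to be nonnegative.\<close>
    have "norm (x s) < \<epsilon>"
      if "reset_solution A R \<sigma> x" "norm (x 0) < \<epsilon> / (K + 1)" "s > 0" for x s
    proof -
      have "norm (x s) \<le> (K + 1) * norm (x 0)"
        using bound[OF that(1,3)] by (simp add: distrib_right add_increasing2)
      also have "\<dots> < \<epsilon>" using that(2) K by (simp add: field_simps)
      finally show ?thesis .
    qed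
    then show "\<exists>\<delta>>0. \<forall>x. reset_solution A R \<sigma> x \<longrightarrow> norm (x 0) < \<delta> \<longrightarrow> (\<forall>s>0. norm (x s) < \<epsilon>)"
      using \<open>\<epsilon> > 0\<close> K by (intro exI[of _ "\<epsilon> / (K + 1)"]) auto
  qed
qed

section \<open>The dwell and flee thresholds give contraction\<close>

lemma mult_exp_le_1:
  fixes y a :: real
  assumes "y \<ge> 0" "ln y + a \<le> 0"
  shows "y * exp a \<le> 1"
\<comment> \<open>At \<open>y = 0\<close> the logarithm is a mere default value, but the product
  vanishes.\<close>
proof (cases "y = 0")
  case False
  then have "y * exp a = exp (ln y + a)" using assms by (simp add: exp_add)
  then show ?thesis using assms by simp
qed simp

theorem theorem3p11:
  fixes A :: "'p::finite \<Rightarrow> (real, 'n::{finite,linorder}) sqmat"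
    and R :: "'p \<Rightarrow> 'p \<Rightarrow> (real, 'n) sqmat"
    and E :: "('p \<times> 'p) set"
    and P J :: "'p \<Rightarrow> (complex, 'n) sqmat"
    and c lam mu :: "'p \<Rightarrow> real"
  assumes "\<And>p. stable_matrix (A p) \<or> unstable_matrix (A p)"
    and "\<And>p q. R p q \<noteq> 0"
    and "\<And>p. \<exists>q. (p, q) \<in> E"
    and "acyclic (unstable_edges A E)"
    and "\<And>p. jordan_decomposition (A p) (P p) (J p)"
    and "\<And>p. c p > 0"
    and "\<And>p. stable_matrix (A p) \<Longrightarrow> lam p > 0 \<and>
           (\<forall>t>0. spectral_norm (matrix_exp (t *\<^sub>R J p)) \<le> c p * exp (- lam p * t))"
    and "\<And>p. unstable_matrix (A p) \<Longrightarrow> mu p > 0 \<and>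
           (\<forall>t>0. spectral_norm (matrix_exp (t *\<^sub>R J p)) \<le> c p * exp (mu p * t))"
  shows "\<forall>\<sigma> \<in> dwell_flee_signals A E (tau_R A R E P c lam) (eta_R A R E P c mu).
           reset_system_stable A R \<sigma>"
proof
  let ?\<tau> = "tau_R A R E P c lam" and ?\<eta> = "eta_R A R E P c mu"
  let ?N = "\<lambda>p q. spectral_norm (matrix_inv (P q) ** cmatrix (R p q) ** P p)"
  fix \<sigma> assume mem: "\<sigma> \<in> dwell_flee_signals A E ?\<tau> ?\<eta>"
  define t where "t = switching_time \<sigma>"
  have sw: "switching_signal \<sigma>"
    and edge: "(\<sigma> (t k), \<sigma> (t (Suc k))) \<in> E"
    and dwell: "stable_matrix (A (\<sigma> (t k))) \<Longrightarrow> ?\<tau> \<le> t (Suc k) - t k"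
    and flee: "unstable_matrix (A (\<sigma> (t k))) \<Longrightarrow> t (Suc k) - t k \<le> ?\<eta>" for k
    using mem by (auto simp: dwell_flee_signals_def admissible_def Let_def t_def)
  define r where "r p = (if stable_matrix (A p) then - lam p else mu p)" for p
  have lt: "t k < t (Suc k)" for k
    using strict_mono_switching_time[OF sw] by (simp add: strict_mono_def t_def)
  show "reset_system_stable A R \<sigma>"
  \<comment> \<open>On unstable intervals the length is at most \<open>?\<eta>\<close>; on stable
    ones the exponent is nonpositive. The maximum with 0 covers both and keeps \<open>C\<close>
    nonnegative even where \<open>?\<eta>\<close> is unspecified.\<close>
  proof (rule reset_system_stable_if_contracting[OF sw assms(5,6), folded t_def,
        where r = r and C = "\<lambda>p. max 0 (r p * ?\<eta>)"])
    show "spectral_norm (matrix_exp (s *\<^sub>R J p)) \<le> c p * exp (r p * s)" if "s > 0" for p s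
      using assms(1)[of p] assms(7,8)[of p] that by (auto simp: r_def)
  next
    fix k
    define p q where "p = \<sigma> (t k)" and "q = \<sigma> (t (Suc k))"
    have pq: "(p, q) \<in> E" using edge by (simp add: p_def q_def)
    \<comment> \<open>The first conjunct is the contraction condition after taking logarithms, the
      form in which the thresholds enter.\<close>
    have "ln (c p * ?N p q) + r p * (t (Suc k) - t k) \<le> 0 \<and>
        r p * (t (Suc k) - t k) \<le> max 0 (r p * ?\<eta>)"
    proof (cases "stable_matrix (A p)")
      case True
      then have lam: "lam p > 0" using assms(7) by blast
      have "ln (c p * ?N p q) / lam p \<le> ?\<tau>"
        unfolding tau_R_def using pq True by (intro Max_ge) (force simp: stable_edges_def)+
      also have "\<dots> \<le> t (Suc k) - t k" using dwell True by (simp add: p_def)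
      finally have "ln (c p * ?N p q) \<le> lam p * (t (Suc k) - t k)"
        using lam by (simp add: field_simps)
      moreover have "0 \<le> lam p * (t (Suc k) - t k)" using lam lt[of k] by simp
      ultimately show ?thesis using True by (simp add: r_def)
    next
      case False
      then have unst: "unstable_matrix (A p)" and mu: "mu p > 0" using assms(1,8) by blast+
      \<comment> \<open>By the minus sign in \<open>eta_R\<close>, \<open>- ?\<eta>\<close> is the
        maximum over the unstable edges, so the upper bound on the length yields a lower bound on
        \<open>- (t (Suc k) - t k)\<close>.\<close>
      have "ln (c p * ?N p q) / mu p \<le> - ?\<eta>"
        unfolding eta_R_def minus_minus
        using pq unst by (intro Max_ge) (force simp: unstable_edges_def)+
      moreover have len: "t (Suc k) - t k \<le> ?\<eta>" using flee unst by (simp add: p_def)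
      ultimately have "ln (c p * ?N p q) / mu p \<le> - (t (Suc k) - t k)" by linarith
      then have "ln (c p * ?N p q) + mu p * (t (Suc k) - t k) \<le> 0"
        using mu by (simp add: field_simps)
      moreover have "mu p * (t (Suc k) - t k) \<le> mu p * ?\<eta>"
        using len mu by (intro mult_left_mono) auto
      ultimately show ?thesis using False by (simp add: r_def)
    qed
    moreover from this have "c p * ?N p q * exp (r p * (t (Suc k) - t k)) \<le> 1"
      using assms(6)[of p] by (intro mult_exp_le_1) (auto simp: spectral_norm_nonneg less_imp_le)
    ultimately show "r (\<sigma> (t k)) * (t (Suc k) - t k) \<le> max 0 (r (\<sigma> (t k)) * ?\<eta>)"
      and "c (\<sigma> (t k)) * ?N (\<sigma> (t k)) (\<sigma> (t (Suc k))) * exp (r (\<sigma> (t k)) * (t (Suc k) - t k)) \<le> 1"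
      by (simp_all add: p_def q_def)
  qed simp
qed

end
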